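(* Let $k\ge 0$ be an integer and let $K_{3,m}$ be the complete bipartite graph with parts of sizes $3$ and $m$. If $m\ge \left\lfloor \frac{k}{3} \right\rfloor + 3$, then \[\ddot{\gamma}_P^k(K_{3,m}) = k + \left\lfloor \frac{k}{3} \right\rfloor +2.\]
   Context: Graphs are finite and simple. For a vertex $v$, $N[v]$ denotes its closed neighborhood. The power domination process on a graph $G$ with initial set $S\subseteq V(G)$: (1) set $B=\bigcup_{v\in S}N[v]$; (2) while there is $v\in B$ with exactly one neighbor $u\notin B$, add $u$ to $B$. A set $S$ is a power dominating set of $G$ if $B=V(G)$ when the process terminates. A multiset of vertices is called a power dominating set if its underlying set is one. For an integer $k\ge 0$, a $k$-robust power dominating set of $G$ is a finite multiset $S$ of elements of $V(G)$ with $|S|\ge k$ (counted with multiplicity) such that for every submultiset $F$ of $S$ with $|F|=k$, the multiset difference $S\setminus F$ is a power dominating set of $G$. $\ddot{\gamma}_P^k(G)$ denotes the minimum cardinality (with multiplicity) of a $k$-robust power dominating set of $G$. *)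

theory Defs
  imports "Graph_Theory.Kuratowski" "HOL-Library.Multiset"
begin

text \<open>
  Finite simple graphs are the symmetric digraphs of locale \<^locale>\<open>graph\<close> (finite, symmetric,
  without loops and without parallel arcs): an edge is a pair of opposite arcs.
\<close>

definition closed_nbhd :: "('a, 'b) pre_digraph \<Rightarrow> 'a \<Rightarrow> 'a set" where
  "closed_nbhd G v = insert v {u. v \<rightarrow>\<^bsub>G\<^esub> u}"

inductive pd_step :: "('a, 'b) pre_digraph \<Rightarrow> 'a set \<Rightarrow> 'a set \<Rightarrow> bool" for G where
  force: "v \<in> B \<Longrightarrow> {w. v \<rightarrow>\<^bsub>G\<^esub> w \<and> w \<notin> B} = {u} \<Longrightarrow> pd_step G B (insert u B)"

definition pd_final :: "('a, 'b) pre_digraph \<Rightarrow> 'a set \<Rightarrow> 'a set \<Rightarrow> bool" where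
  "pd_final G S B \<longleftrightarrow> (pd_step G)\<^sup>*\<^sup>* (\<Union>v\<in>S. closed_nbhd G v) B \<and> (\<nexists>B'. pd_step G B B')"

text \<open>
  The process may have a choice of forcing vertices, but the set with which it terminates does not
  depend on these choices; hence it does not matter which terminating run is considered.
\<close>

lemma pd_reachable_subset_final:
  assumes "(pd_step G)\<^sup>*\<^sup>* A C" "A \<subseteq> B" "\<nexists>B'. pd_step G B B'"
  shows "C \<subseteq> B"
  using assms(1)
proof (induction rule: rtranclp_induct)
  case base
  show ?case by (rule assms(2))
next
  case (step C D)
  from step.hyps(2) show ?case
  proof cases
    case (force v u)
    have "u \<in> B"
    proof (rule ccontr)
      assume "u \<notin> B"
      with force step.IH have "{w. v \<rightarrow>\<^bsub>G\<^esub> w \<and> w \<notin> B} = {u}" by blast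
      moreover have "v \<in> B" using force step.IH by blast
      ultimately show False using pd_step.force assms(3) by metis
    qed
    with force step.IH show ?thesis by blast
  qed
qed

lemma pd_step_mono: "(pd_step G)\<^sup>*\<^sup>* A B \<Longrightarrow> A \<subseteq> B"
  by (induction rule: rtranclp_induct) (auto elim: pd_step.cases)

lemma pd_final_unique: "pd_final G S B \<Longrightarrow> pd_final G S C \<Longrightarrow> B = C"
  unfolding pd_final_def by (meson pd_reachable_subset_final pd_step_mono subset_antisym)

definition power_dominating_set :: "('a, 'b) pre_digraph \<Rightarrow> 'a set \<Rightarrow> bool" where
  "power_dominating_set G S \<longleftrightarrow> S \<subseteq> verts G \<and> pd_final G S (verts G)"

definition robust_power_dominating_set :: "nat \<Rightarrow> ('a, 'b) pre_digraph \<Rightarrow> 'a multiset \<Rightarrow> bool" where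
  "robust_power_dominating_set k G S \<longleftrightarrow>
     set_mset S \<subseteq> verts G \<and> size S \<ge> k \<and>
     (\<forall>F. F \<subseteq># S \<and> size F = k \<longrightarrow> power_dominating_set G (set_mset (S - F)))"

definition robust_power_domination_number :: "nat \<Rightarrow> ('a, 'b) pre_digraph \<Rightarrow> nat" where
  "robust_power_domination_number k G =
     (LEAST n. \<exists>S. robust_power_dominating_set k G S \<and> size S = n)"

end

theory Submission
  imports Defs
begin

text \<open>
  A set of vertices of \<open>K\<^bsub>3,m\<^esub>\<close> fails to be power dominating if it consists of at most one vertex
  of the part of size \<open>3\<close>, or of at most \<open>m - 2\<close> vertices of the other part. If \<open>S\<close> has size
  \<open>k + t\<close>, its submultisets of size \<open>t\<close> must avoid both situations, so \<open>S\<close> contains each of the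
  three vertices, and the other part as a whole, at most \<open>t - 1\<close> times. Hence \<open>k + t \<le> 4(t - 1)\<close>.
  Conversely, take the three vertices and one vertex of the other part: any two of these four power
  dominate, so a multiset \<open>S\<close> containing each of them at most \<open>t - 1\<close> times attains the bound.
\<close>

text \<open>Certificate of failure: by \<open>pd_reachable_subset_final\<close>, a stalled set
  \<open>B\<close> that contains the initially dominated vertices traps every run, so a vertex
  outside \<open>B\<close> is never reached.\<close>

lemma not_power_dominatingI:
  assumes "(\<Union>v\<in>S. closed_nbhd G v) \<subseteq> B" "\<nexists>B'. pd_step G B B'" "\<not> verts G \<subseteq> B"
  shows "\<not> power_dominating_set G S"
proof
  assume "power_dominating_set G S"
  then have "(pd_step G)\<^sup>*\<^sup>* (\<Union>v\<in>S. closed_nbhd G v) (verts G)"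
    by (simp add: power_dominating_set_def pd_final_def)
  then show False
    using pd_reachable_subset_final[OF _ assms(1,2)] assms(3) by simp
qed

lemma ex_submultiset_size:
  assumes "n \<le> size M"
  shows "\<exists>N. N \<subseteq># M \<and> size N = n"
proof -
  obtain xs where M: "M = mset xs" using ex_mset by metis
  have "mset (take n xs) \<subseteq># mset xs"
    by (metis append_take_drop_id mset_append mset_subset_eq_add_left)
  then show ?thesis using assms M by (intro exI[of _ "mset (take n xs)"]) simp
qed

text \<open>Passes from deleted to surviving submultisets: \<open>N\<close> is what remains of
  \<open>S\<close> once its complement \<open>S - N\<close>, of size \<open>k\<close>, is
  deleted.\<close>

lemma robust_power_dominating_setD:
  assumes "robust_power_dominating_set k G S" "N \<subseteq># S" "size S = k + size N"
  shows "power_dominating_set G (set_mset N)"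
proof -
  have "size (S - N) = k" using assms(2,3) by (simp add: size_Diff_submset)
  moreover have "S - (S - N) = N" using assms(2) by (auto simp: multiset_eq_iff subseteq_mset_def)
  ultimately show ?thesis
    using assms(1) unfolding robust_power_dominating_set_def by (metis diff_subset_eq_self)
qed

text \<open>The part sizes stay open and the axioms are symmetric in \<open>U\<close> and
  \<open>V\<close>, so that by \<open>swap\<close> a fact about one part can be reused for the
  other.\<close>

locale bipartition =
  fixes G :: "('a, 'b) pre_digraph" and U V :: "'a set"
  assumes verts: "verts G = U \<union> V" and disj: "U \<inter> V = {}"
    and arcs: "arcs_ends G = U \<times> V \<union> V \<times> U"
    and fin: "finite U" "finite V"
begin

lemma swap: "bipartition G V U"
  using verts disj arcs fin by unfold_locales auto

lemma dominates_iff: "x \<rightarrow>\<^bsub>G\<^esub> y \<longleftrightarrow> x \<in> U \<and> y \<in> V \<or> x \<in> V \<and> y \<in> U"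
  by (simp add: arcs)

lemma nbhd_left: "x \<in> U \<Longrightarrow> closed_nbhd G x = insert x V"
  and nbhd_right: "x \<in> V \<Longrightarrow> closed_nbhd G x = insert x U"
  using disj by (auto simp: closed_nbhd_def dominates_iff)

text \<open>The set \<open>U \<union> S\<close> is stalled: a vertex of \<open>U\<close> still sees
  all of \<open>V - S\<close>, which has at least two elements, and a vertex of \<open>S\<close> has
  all its neighbors in \<open>U\<close>.\<close>

lemma not_power_dominating_part:
  assumes "S \<subseteq> V" "card S + 2 \<le> card V"
  shows "\<not> power_dominating_set G S"
proof (rule not_power_dominatingI)
  show "(\<Union>v\<in>S. closed_nbhd G v) \<subseteq> U \<union> S"
    using assms(1) by (auto simp: nbhd_right)
  have "card (V - S) \<ge> 2"
    using assms fin by (simp add: card_Diff_subset finite_subset)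
  then have ne: "V - S \<noteq> {x}" "V - S \<noteq> {}" for x
    by (force simp del: Diff_eq_empty_iff)+
  show "\<nexists>B'. pd_step G (U \<union> S) B'"
  proof
    assume "\<exists>B'. pd_step G (U \<union> S) B'"
    then obtain v u where v: "v \<in> U \<union> S" and eq: "{w. v \<rightarrow>\<^bsub>G\<^esub> w \<and> w \<notin> U \<union> S} = {u}"
      by (auto elim!: pd_step.cases)
    show False
    proof (cases "v \<in> U")
      case True
      then have "{w. v \<rightarrow>\<^bsub>G\<^esub> w \<and> w \<notin> U \<union> S} = V - S"
        using disj by (auto simp: dominates_iff)
      then show False using eq ne by simp
    next
      case False
      then have "{w. v \<rightarrow>\<^bsub>G\<^esub> w \<and> w \<notin> U \<union> S} = {}" by (auto simp: dominates_iff)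
      then show False using eq by blast
    qed
  qed
  show "\<not> verts G \<subseteq> U \<union> S" using ne disj verts by blast
qed

lemma no_step_verts: "\<nexists>B'. pd_step G (verts G) B'"
proof
  assume "\<exists>B'. pd_step G (verts G) B'"
  then obtain v u where "{w. v \<rightarrow>\<^bsub>G\<^esub> w \<and> w \<notin> verts G} = {u}"
    by (metis pd_step.cases)
  then have "v \<rightarrow>\<^bsub>G\<^esub> u" "u \<notin> verts G" by auto
  then show False by (auto simp: dominates_iff verts)
qed

lemma power_dominating_both:
  assumes "S \<subseteq> verts G" "u \<in> S" "u \<in> U" "v \<in> S" "v \<in> V"
  shows "power_dominating_set G S"
proof -
  have "closed_nbhd G x \<subseteq> verts G" if "x \<in> S" for x
    using assms(1) that verts by (auto simp: closed_nbhd_def dominates_iff)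
  moreover have "verts G \<subseteq> closed_nbhd G u \<union> closed_nbhd G v"
    using assms by (auto simp: nbhd_left nbhd_right verts)
  ultimately have "(\<Union>x\<in>S. closed_nbhd G x) = verts G" using assms(2,4) by blast
  then show ?thesis
    using assms(1) no_step_verts by (simp add: power_dominating_set_def pd_final_def)
qed

text \<open>Domination yields \<open>S \<union> V\<close>. At most one vertex of \<open>U\<close> is
  then missing, and any vertex of \<open>V\<close> forces it.\<close>

lemma power_dominating_left:
  assumes "S \<subseteq> U" "S \<noteq> {}" "card U \<le> Suc (card S)" "V \<noteq> {}"
  shows "power_dominating_set G S"
proof -
  have N: "(\<Union>x\<in>S. closed_nbhd G x) = S \<union> V"
  proof -
    have "(\<Union>x\<in>S. closed_nbhd G x) = (\<Union>x\<in>S. insert x V)"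
      using assms(1) nbhd_left by (intro SUP_cong) auto
    then show ?thesis using assms(2) by auto
  qed
  have "(pd_step G)\<^sup>*\<^sup>* (S \<union> V) (U \<union> V)"
  proof (cases "S = U")
    case False
    have "card (U - S) \<le> 1" "finite (U - S)"
      using assms fin by (auto simp: card_Diff_subset finite_subset)
    moreover have "U - S \<noteq> {}" using False assms(1) by blast
    ultimately have "card (U - S) = 1" by (simp add: le_Suc_eq)
    then obtain w where w: "U - S = {w}" by (auto simp: card_1_singleton_iff)
    obtain v where v: "v \<in> V" using assms(4) by blast
    have "{x. v \<rightarrow>\<^bsub>G\<^esub> x \<and> x \<notin> S \<union> V} = {w}"
      using v w disj by (auto simp: dominates_iff)
    then have "pd_step G (S \<union> V) (insert w (S \<union> V))"
      using v pd_step.force[of v "S \<union> V" G w] by blast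
    moreover have "insert w (S \<union> V) = U \<union> V" using w assms(1) by blast
    ultimately show ?thesis by (metis r_into_rtranclp)
  qed simp
  then show ?thesis
    unfolding power_dominating_set_def pd_final_def N
    using assms(1) no_step_verts verts by simp blast
qed

end

lemma robust_lower_bound:
  assumes "bipartition G U V" "card U = 3" "card V \<ge> k div 3 + 3"
    and rob: "robust_power_dominating_set k G S"
  shows "k + k div 3 + 2 \<le> size S"
proof (rule ccontr)
  interpret bipartition G U V by fact
  interpret sw: bipartition G V U by (rule swap)
  assume less: "\<not> k + k div 3 + 2 \<le> size S"
  define t where "t = size S - k"
  have S: "size S = k + t" "set_mset S \<subseteq> U \<union> V"
    using rob verts by (auto simp: robust_power_dominating_set_def t_def)
  \<comment> \<open>The assumed failure of the bound means \<open>t \<le> k div 3 + 1\<close>; both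
    estimates follow from this, the first with the hypothesis on \<open>card V\<close>.\<close>
  have t: "t + 2 \<le> card V" "3 * t \<le> k + 3" using less S(1) assms(3) by linarith+
  have card_le: "card (set_mset N) \<le> size N" for N :: "'a multiset"
  proof -
    obtain xs where "N = mset xs" using ex_mset by metis
    then show ?thesis by (simp add: card_length)
  qed
  \<comment> \<open>If \<open>S\<close> had \<open>t\<close> elements satisfying \<open>P\<close>,
    deleting the other \<open>k\<close> elements would leave a set that does not power
    dominate.\<close>
  have part: "size (filter_mset P S) < t"
    if "\<And>N. N \<subseteq># filter_mset P S \<Longrightarrow> size N = t \<Longrightarrow> \<not> power_dominating_set G (set_mset N)" for P
  proof (rule ccontr)
    assume "\<not> ?thesis"
    then obtain N where N: "N \<subseteq># filter_mset P S" "size N = t"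
      using ex_submultiset_size by (metis not_less)
    then have "N \<subseteq># S" by (meson multiset_filter_subset subset_mset.order_trans)
    then show False
      using robust_power_dominating_setD[OF rob] N S(1) that by auto
  qed
  have V: "size (filter_mset (\<lambda>x. x \<in> V) S) < t"
  proof (rule part)
    fix N assume N: "N \<subseteq># filter_mset (\<lambda>x. x \<in> V) S" "size N = t"
    have "set_mset N \<subseteq> V" using set_mset_mono[OF N(1)] by auto
    then show "\<not> power_dominating_set G (set_mset N)"
      using not_power_dominating_part card_le[of N] N(2) t(1) by simp
  qed
  have u: "count S u < t" if "u \<in> U" for u
  proof -
    have "size (filter_mset (\<lambda>x. x = u) S) < t"
    proof (rule part)
      fix N assume "N \<subseteq># filter_mset (\<lambda>x. x = u) S" "size N = t"
      then have *: "set_mset N \<subseteq> {u}" using set_mset_mono by fastforce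
      then have "card (set_mset N) \<le> 1" using card_mono[OF _ *] by simp
      then show "\<not> power_dominating_set G (set_mset N)"
        \<comment> \<open>With the parts exchanged: a single vertex leaves two of the three vertices
          of \<open>U\<close> unobserved.\<close>
        using sw.not_power_dominating_part[of "set_mset N"] * that assms(2) by auto
    qed
    then show ?thesis by (simp add: filter_eq_replicate_mset)
  qed
  have "size S = sum (count S) (U \<union> V)"
    unfolding size_multiset_overloaded_eq using S(2) fin
    by (intro sum.mono_neutral_left) (auto simp: not_in_iff)
  also have "\<dots> = sum (count S) U + sum (count S) V"
    using disj fin by (simp add: sum.union_disjoint)
  also have "sum (count S) V = size (filter_mset (\<lambda>x. x \<in> V) S)"
    unfolding size_multiset_overloaded_eq using fin
    by (intro sum.mono_neutral_cong_right) (auto simp: not_in_iff)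
  also have "sum (count S) U \<le> card U * (t - 1)"
  proof -
    have "count S x \<le> t - 1" if "x \<in> U" for x using u[OF that] by simp
    then show ?thesis using sum_bounded_above[of U "count S" "t - 1"] by simp
  qed
  \<comment> \<open>Since \<open>V\<close> gives \<open>t \<ge> 1\<close>, the subtraction
    \<open>t - 1\<close> is exact. Thus \<open>k + t \<le> 4 * (t - 1)\<close>, that is
    \<open>k + 4 \<le> 3 * t\<close>, against \<open>t(2)\<close>.\<close>
  finally show False using V t(2) S(1) assms(2) by simp
qed

lemma robust_attained:
  assumes "bipartition G U V" "card U = 3" "V \<noteq> {}"
  shows "\<exists>S. robust_power_dominating_set k G S \<and> size S = k + k div 3 + 2"
proof -
  interpret bipartition G U V by fact
  obtain v where v: "v \<in> V" using assms(3) by blast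
  define W where "W = insert v U"
  have W: "card W = 4" "finite W" "W \<subseteq> verts G"
    using v disj assms(2) fin by (auto simp: W_def verts card_insert_if)
  define q where "q = k div 3"
  define M where "M = (\<Sum>w\<in>W. replicate_mset (Suc q) w)"
  have size_M: "size M = 4 * Suc q"
    by (simp add: M_def W(1) size_multiset_sum)
  have count_M: "count M x = (if x \<in> W then Suc q else 0)" for x
    using W(2) by (simp add: M_def count_sum del: replicate_mset_Suc)
  \<comment> \<open>Because \<open>k \<le> 3 * q + 2\<close>, four vertices with
    \<open>q + 1\<close> copies each suffice; any submultiset of the required size will do.\<close>
  have "k + q + 2 \<le> size M" unfolding size_M q_def by presburger
  then obtain S where S: "S \<subseteq># M" "size S = k + q + 2"
    using ex_submultiset_size by blast
  have "power_dominating_set G (set_mset (S - F))" if "F \<subseteq># S" "size F = k" for F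
  proof -
    let ?N = "S - F"
    have N: "?N \<subseteq># M" using S(1) by (meson diff_subset_eq_self subset_mset.order_trans)
    have sizeN: "size ?N = q + 2" using that S(2) by (simp add: size_Diff_submset)
    have count_N: "count ?N x \<le> Suc q" for x
      using mset_subset_eq_count[OF N, of x] count_M[of x] by (simp split: if_splits)
    have sub: "set_mset ?N \<subseteq> W"
    proof
      fix x assume "x \<in># ?N"
      then have "x \<in># M" using N by (rule mset_subset_eqD[rotated])
      then show "x \<in> W" using count_M[of x] by (metis count_eq_zero_iff)
    qed
    \<comment> \<open>Pigeonhole: \<open>q + 2\<close> elements survive, but each vertex occurs at
      most \<open>q + 1\<close> times, so two distinct vertices survive.\<close>
    have "size ?N \<le> card (set_mset ?N) * Suc q"
      unfolding size_multiset_overloaded_eq using sum_bounded_above[of "set_mset ?N" "count ?N" "Suc q"] count_N by simp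
    moreover have "card (set_mset ?N) * Suc q \<le> Suc q" if "card (set_mset ?N) \<le> 1"
      using mult_le_mono1[OF that, of "Suc q"] by simp
    ultimately have card: "card (set_mset ?N) \<ge> 2"
      unfolding sizeN by linarith
    \<comment> \<open>Of two distinct vertices of \<open>W\<close>, at most one is
      \<open>v\<close>.\<close>
    have "\<exists>u \<in> set_mset ?N. u \<in> U"
    proof (rule ccontr)
      assume "\<not> ?thesis"
      then have "set_mset ?N \<subseteq> {v}" using sub by (auto simp: W_def)
      then show False using card card_mono[of "{v}" "set_mset ?N"] by simp
    qed
    then obtain u where u: "u \<in># ?N" "u \<in> U" by blast
    show ?thesis
    proof (cases "v \<in># ?N")
      case True
      then show ?thesis using power_dominating_both u v sub W(3) by blast
    next
      case False
      then have "set_mset ?N \<subseteq> U" using sub by (auto simp: W_def)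
      moreover have "set_mset ?N \<noteq> {}" using u(1) by blast
      moreover have "card U \<le> Suc (card (set_mset ?N))" using card assms(2) by linarith
      ultimately show ?thesis using assms(3) by (rule power_dominating_left)
    qed
  qed
  moreover have "set_mset S \<subseteq> verts G"
  proof
    fix x assume "x \<in># S"
    then have "x \<in># M" using S(1) by (rule mset_subset_eqD[rotated])
    then show "x \<in> verts G" using count_M[of x] W(3) by (metis count_eq_zero_iff subsetD)
  qed
  ultimately have "robust_power_dominating_set k G S"
    using S(2) by (simp add: robust_power_dominating_set_def)
  then show ?thesis using S(2) q_def by auto
qed

theorem theorem4p4:
  fixes G :: "('a, 'b) pre_digraph" and k m :: nat
  assumes "K\<^bsub>3,m\<^esub> G"
    and "m \<ge> k div 3 + 3"
  shows "robust_power_domination_number k G = k + k div 3 + 2"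
proof -
  obtain U V where UV: "verts G = U \<union> V" "U \<inter> V = {}" "card U = 3" "card V = m"
    "arcs_ends G = U \<times> V \<union> V \<times> U"
    using assms(1) unfolding complete_bipartite_digraph_def by blast
  \<comment> \<open>An infinite set has \<open>card\<close> equal to 0, so the positive
    cardinalities of both parts give finiteness.\<close>
  have "finite U" "finite V"
    using UV(3,4) assms(2) by (auto intro!: card_ge_0_finite)
  then have bip: "bipartition G U V" using UV by unfold_locales auto
  have "V \<noteq> {}" using UV(4) assms(2) by auto
  show ?thesis
    unfolding robust_power_domination_number_def
  proof (rule Least_equality)
    show "\<exists>S. robust_power_dominating_set k G S \<and> size S = k + k div 3 + 2"
      using robust_attained[OF bip UV(3) \<open>V \<noteq> {}\<close>] .
  next
    fix n assume "\<exists>S. robust_power_dominating_set k G S \<and> size S = n"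
    then show "k + k div 3 + 2 \<le> n"
      using robust_lower_bound[OF bip UV(3)] UV(4) assms(2) by blast
  qed
qed

end
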